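(* Let $A$ be a $2\times 2$ doubly nonnegative matrix with nonnegative integer entries. Then $A=BB^T$ for some $2\times 10$ matrix $B$ with nonnegative integer entries; i.e., the integer CP rank of $A$ is at most $10$.
   Context: A matrix is doubly nonnegative if it is symmetric positive semidefinite and entrywise nonnegative. The integer CP rank of $A$ is the smallest number of columns of a nonnegative integer matrix $B$ with $A=BB^T$. *)

theory Defs
  imports Complex_Main "Jordan_Normal_Form.Matrix" "HOL-Library.Extended_Nat"
begin

definition symmetric_mat :: "'a mat \<Rightarrow> bool" where
  "symmetric_mat A \<longleftrightarrow> transpose_mat A = A"

definition pos_semidef_mat :: "real mat \<Rightarrow> bool" where
  "pos_semidef_mat A \<longleftrightarrow>
     square_mat A \<and> (\<forall>x \<in> carrier_vec (dim_row A). 0 \<le> x \<bullet> (A *\<^sub>v x))"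

definition nonneg_mat :: "real mat \<Rightarrow> bool" where
  "nonneg_mat A \<longleftrightarrow> (\<forall>a \<in> elements_mat A. 0 \<le> a)"

definition integer_mat :: "real mat \<Rightarrow> bool" where
  "integer_mat A \<longleftrightarrow> elements_mat A \<subseteq> \<int>"

definition doubly_nonneg_mat :: "real mat \<Rightarrow> bool" where
  "doubly_nonneg_mat A \<longleftrightarrow> symmetric_mat A \<and> pos_semidef_mat A \<and> nonneg_mat A"

text \<open>
  The infimum is taken in \<^typ>\<open>enat\<close>, so it is the minimum if \<open>A\<close> has an integer completely
  positive factorization and \<open>\<infinity>\<close> if it has none.  A factor with no columns is allowed; this only
  matters for the zero matrix, whose rank is \<open>0\<close>.
\<close>

definition integer_cp_rank :: "real mat \<Rightarrow> enat" where
  "integer_cp_rank A =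
     (INF B \<in> {B. nonneg_mat B \<and> integer_mat B \<and> A = B * transpose_mat B}. enat (dim_col B))"

end

theory Submission
  imports Defs "HOL-Computational_Algebra.Primes" "HOL-Library.Discrete_Functions"
begin

text \<open>
  Let \<open>A\<close> have diagonal \<open>a, c\<close> and off-diagonal entry \<open>b\<close>.  If \<open>b > a\<close>, subtracting the first row of
  the wanted factor from the second gives the smaller problem \<open>(a, b - a, c - 2 * b + a)\<close> with the
  same determinant; so one may assume \<open>a = b + s\<close> and \<open>c = b + t\<close> with \<open>t \<le> s\<close>.  Writing each of
  \<open>b, s, t\<close> as four squares would cost twelve columns \<open>(p, p)\<close>, \<open>(p, 0)\<close>, \<open>(0, p)\<close>.  If \<open>t \<le> b + 1\<close>, a
  single column with two consecutive entries adjusts \<open>t\<close> to a square, and the four columns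
  for \<open>t\<close> shrink to one: \<open>1 + 1 + 4 + 4\<close>.  If both \<open>s\<close> and \<open>t\<close> exceed \<open>b + 1\<close>, the entry \<open>b\<close> can be
  produced by two columns alone, and four squares complete each diagonal entry: \<open>2 + 4 + 4\<close>.
\<close>

section \<open>Lagrange's four-square theorem\<close>

definition sum4sq :: "int \<Rightarrow> bool" where
  "sum4sq n \<longleftrightarrow> (\<exists>a b c d. n = a\<^sup>2 + b\<^sup>2 + c\<^sup>2 + d\<^sup>2)"

text \<open>Multiplicativity of the quaternion norm with one factor conjugated. These signs suit the
  descent: if \<open>w, x, y, z\<close> are congruent to \<open>a, b, c, d\<close> modulo
  \<open>m\<close>, the last three sums vanish modulo \<open>m\<close>.\<close>

lemma euler_four_square:
  fixes a b c d w x y z :: int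
  shows "(a\<^sup>2 + b\<^sup>2 + c\<^sup>2 + d\<^sup>2) * (w\<^sup>2 + x\<^sup>2 + y\<^sup>2 + z\<^sup>2) =
    (a*w + b*x + c*y + d*z)\<^sup>2 + (a*x - b*w + c*z - d*y)\<^sup>2 +
    (a*y - c*w + d*x - b*z)\<^sup>2 + (a*z - d*w + b*y - c*x)\<^sup>2"
  by Groebner_Basis.algebra

lemma sum4sq_mult:
  assumes "sum4sq m" "sum4sq n"
  shows "sum4sq (m * n)"
proof -
  obtain a b c d where m: "m = a\<^sup>2 + b\<^sup>2 + c\<^sup>2 + d\<^sup>2" using assms(1) unfolding sum4sq_def by blast
  obtain w x y z where n: "n = w\<^sup>2 + x\<^sup>2 + y\<^sup>2 + z\<^sup>2" using assms(2) unfolding sum4sq_def by blast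
  show ?thesis unfolding m n euler_four_square sum4sq_def by blast
qed

lemma inj_on_square_mod_prime:
  fixes p :: int
  assumes "prime p" "odd p"
  shows "inj_on (\<lambda>x. x\<^sup>2 mod p) {0..p div 2}"
proof (rule inj_onI)
  fix x y assume xy: "x \<in> {0..p div 2}" "y \<in> {0..p div 2}" and "x\<^sup>2 mod p = y\<^sup>2 mod p"
  then have "p dvd x\<^sup>2 - y\<^sup>2" by (simp add: mod_eq_dvd_iff)
  then have "p dvd (x - y) * (x + y)" by (simp add: power2_eq_square algebra_simps)
  then consider "p dvd x - y" | "p dvd x + y"
    using assms(1) prime_dvd_mult_iff by blast
  then show "x = y"
  proof cases
    case 1
    have "\<bar>x - y\<bar> < p" using xy assms prime_gt_1_int[OF assms(1)] by auto
    then show ?thesis using 1 dvd_imp_le_int[of "x - y" p] by fastforce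
  next
    case 2
    have "x + y < p" using xy assms by (auto elim!: oddE)
    then have "x + y = 0" using 2 xy zdvd_imp_le[of p "x + y"] by fastforce
    then show ?thesis using xy by auto
  qed
qed

text \<open>Pigeonhole: \<open>x\<^sup>2\<close> and \<open>- 1 - y\<^sup>2\<close> each take (p +
  1)/2 distinct residues on the range, together more than \<open>p\<close>, so some residue is
  shared.\<close>

lemma prime_dvd_two_squares_plus_one:
  fixes p :: int
  assumes "prime p" "odd p"
  obtains x y where "0 \<le> x" "x \<le> p div 2" "0 \<le> y" "y \<le> p div 2" "p dvd x\<^sup>2 + y\<^sup>2 + 1"
proof -
  let ?I = "{0..p div 2}"
  let ?f = "\<lambda>x. x\<^sup>2 mod p" and ?g = "\<lambda>y. (- 1 - y\<^sup>2) mod p"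
  have p: "p > 1" using assms prime_gt_1_int by blast
  have f: "inj_on ?f ?I" by (rule inj_on_square_mod_prime[OF assms])
  have "inj_on ?g ?I"
  proof (rule inj_onI)
    fix x y assume xy: "x \<in> ?I" "y \<in> ?I" and "?g x = ?g y"
    then have "p dvd y\<^sup>2 - x\<^sup>2" by (simp add: mod_eq_dvd_iff)
    then have "?f y = ?f x" by (simp add: mod_eq_dvd_iff)
    then show "x = y" using f xy by (metis inj_onD)
  qed
  then have card: "card (?f ` ?I) = nat (p div 2 + 1)" "card (?g ` ?I) = nat (p div 2 + 1)"
    using f by (simp_all add: card_image)
  have "?f ` ?I \<inter> ?g ` ?I \<noteq> {}"
  proof
    assume "?f ` ?I \<inter> ?g ` ?I = {}"
    then have "card (?f ` ?I \<union> ?g ` ?I) = 2 * nat (p div 2 + 1)"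
      using card by (simp add: card_Un_disjoint)
    moreover have "?f ` ?I \<union> ?g ` ?I \<subseteq> {0..<p}" using p by auto
    then have "card (?f ` ?I \<union> ?g ` ?I) \<le> nat p"
      using card_mono[of "{0..<p}"] by fastforce
    ultimately have "2 * nat (p div 2 + 1) \<le> nat p" by metis
    moreover obtain q where "p = 2 * q + 1" using assms(2) by (blast elim: oddE)
    ultimately show False using p by simp
  qed
  then obtain x y where "x \<in> ?I" "y \<in> ?I" "?f x = ?g y" by blast
  moreover from this have "p dvd x\<^sup>2 + y\<^sup>2 + 1" by (simp add: mod_eq_dvd_iff algebra_simps)
  ultimately show ?thesis using that by auto
qed

text \<open>The four terms split into two pairs of equal parity, and (a^2 + b^2)/2 = ((a + b)/2)^2 +
  ((a - b)/2)^2 halves each pair.\<close>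

lemma sum4sq_half:
  assumes "sum4sq (2 * n)"
  shows "sum4sq n"
proof -
  obtain a b c d where e: "2 * n = a\<^sup>2 + b\<^sup>2 + c\<^sup>2 + d\<^sup>2"
    using assms sum4sq_def by blast
  have *: "sum4sq n" if h: "even (a + b)" "even (c + d)" "2 * n = a\<^sup>2 + b\<^sup>2 + c\<^sup>2 + d\<^sup>2"
    for a b c d :: int
  proof -
    obtain u where u: "a + b = 2 * u" using h(1) by (rule evenE)
    obtain v where v: "c + d = 2 * v" using h(2) by (rule evenE)
    have ab: "b = 2 * u - a" "d = 2 * v - c" using u v by linarith+
    have "n = u\<^sup>2 + (u - a)\<^sup>2 + v\<^sup>2 + (v - c)\<^sup>2"
      using h(3) unfolding ab by (simp add: power2_eq_square algebra_simps)
    then show ?thesis unfolding sum4sq_def by blast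
  qed
  have "even (a\<^sup>2 + b\<^sup>2 + c\<^sup>2 + d\<^sup>2)" using e by (metis dvd_triv_left)
  then have "even (a + b + c + d)" by simp
  then consider "even (a + b)" "even (c + d)" | "even (a + c)" "even (b + d)"
    | "even (a + d)" "even (b + c)" by auto
  then show ?thesis
    using *[of a b c d] *[of a c b d] *[of a d b c] e by cases simp_all
qed

text \<open>Oddness makes the bound strict, and this is what makes the new multiplier in the descent
  strictly smaller than \<open>m\<close>.\<close>

lemma odd_centered_residue:
  fixes m a :: int
  assumes "odd m" "m > 0"
  obtains r where "m dvd a - r" "2 * \<bar>r\<bar> < m"
proof (cases "2 * (a mod m) < m")
  case True
  show ?thesis by (rule that[of "a mod m"]) (use True assms in \<open>auto simp: minus_mod_eq_mult_div\<close>)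
next
  case False
  then have "2 * (a mod m) \<noteq> m" using assms by (metis dvd_triv_left)
  moreover have "a mod m < m" using assms by simp
  moreover have "a - (a mod m - m) = m * (a div m + 1)"
    by (simp add: minus_mod_eq_mult_div algebra_simps flip: add_diff_eq)
  ultimately show ?thesis using False by (intro that[of "a mod m - m"]) auto
qed

text \<open>The centered residues of \<open>a, b, c, d\<close> have a sum of squares
  \<open>m * k\<close> with \<open>k < m\<close>. Euler's identity writes
  \<open>(m * p) * (m * k)\<close> as four squares of multiples of \<open>m\<close>; dividing by
  \<open>m\<^sup>2\<close> leaves \<open>k * p\<close>.\<close>

lemma sum4sq_descent:
  assumes "sum4sq (m * p)" "odd m" "m > 1" "\<not> m dvd p"
  obtains r where "0 < r" "r < m" "sum4sq (r * p)"
proof -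
  obtain a b c d where e: "m * p = a\<^sup>2 + b\<^sup>2 + c\<^sup>2 + d\<^sup>2"
    using assms sum4sq_def by blast
  have m0: "m > 0" using assms by simp
  note residue = odd_centered_residue[OF assms(2) m0]
  obtain w where w: "m dvd a - w" "2 * \<bar>w\<bar> < m" using residue .
  obtain x where x: "m dvd b - x" "2 * \<bar>x\<bar> < m" using residue .
  obtain y where y: "m dvd c - y" "2 * \<bar>y\<bar> < m" using residue .
  obtain z where z: "m dvd d - z" "2 * \<bar>z\<bar> < m" using residue .
  obtain a' where a': "a - w = m * a'" using w(1) by (rule dvdE)
  obtain b' where b': "b - x = m * b'" using x(1) by (rule dvdE)
  obtain c' where c': "c - y = m * c'" using y(1) by (rule dvdE)
  obtain d' where d': "d - z = m * d'" using z(1) by (rule dvdE)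
  then have ab: "a = w + m * a'" "b = x + m * b'" "c = y + m * c'" "d = z + m * d'"
    using a' b' c' d' by simp_all
  define n where "n = w\<^sup>2 + x\<^sup>2 + y\<^sup>2 + z\<^sup>2"
  have "n = m * (p - 2 * (w*a' + x*b' + y*c' + z*d') - m * (a'\<^sup>2 + b'\<^sup>2 + c'\<^sup>2 + d'\<^sup>2))"
    using e unfolding ab n_def by (simp add: power2_eq_square algebra_simps)
  then obtain k where k: "n = m * k" by blast
  have sq: "4 * u\<^sup>2 < m\<^sup>2" if "2 * \<bar>u\<bar> < m" for u
    using power_strict_mono[OF that, of 2] by (simp add: power_mult_distrib)
  have "4 * n < 4 * m\<^sup>2" using sq[OF w(2)] sq[OF x(2)] sq[OF y(2)] sq[OF z(2)] n_def by linarith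
  then have km: "k < m" using m0 k by (simp add: power2_eq_square)
  \<comment> \<open>Otherwise \<open>m\<close> divides each of \<open>a, b, c, d\<close>, so
    \<open>m\<^sup>2\<close> divides \<open>m * p\<close> and \<open>m\<close> divides
    \<open>p\<close>.\<close>
  have "k \<noteq> 0"
  proof
    assume "k = 0"
    then have "w\<^sup>2 + x\<^sup>2 + y\<^sup>2 + z\<^sup>2 = 0" using k n_def by simp
    then have "w = 0" "x = 0" "y = 0" "z = 0" by (simp_all add: add_nonneg_eq_0_iff)
    then have "m * p = m * (m * (a'\<^sup>2 + b'\<^sup>2 + c'\<^sup>2 + d'\<^sup>2))"
      using e ab by (simp add: power2_eq_square algebra_simps)
    then show False using m0 assms(4) by simp
  qed
  moreover have "0 \<le> m * k" unfolding k[symmetric] n_def by simp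
  ultimately have k0: "k > 0" using m0 by (simp add: zero_le_mult_iff)
  \<comment> \<open>These are Euler's four sums divided by \<open>m\<close>: products of two
    residues cancel in the last three and add up to \<open>n = m * k\<close> in the first.\<close>
  let ?A = "k + a'*w + b'*x + c'*y + d'*z" and ?B = "a'*x - b'*w + c'*z - d'*y"
    and ?C = "a'*y - c'*w + d'*x - b'*z" and ?D = "a'*z - d'*w + b'*y - c'*x"
  have "m\<^sup>2 * (k * p) = (m * p) * n" using k by (simp add: power2_eq_square)
  also have "\<dots> = (a*w + b*x + c*y + d*z)\<^sup>2 + (a*x - b*w + c*z - d*y)\<^sup>2 +
    (a*y - c*w + d*x - b*z)\<^sup>2 + (a*z - d*w + b*y - c*x)\<^sup>2"
    unfolding e n_def by (rule euler_four_square)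
  also have "a*w + b*x + c*y + d*z = n + m * (a'*w + b'*x + c'*y + d'*z)"
    unfolding ab n_def by (simp add: power2_eq_square algebra_simps)
  also have "\<dots> = m * ?A" unfolding k by (simp add: algebra_simps)
  also have "a*x - b*w + c*z - d*y = m * ?B" unfolding ab by (simp add: algebra_simps)
  also have "a*y - c*w + d*x - b*z = m * ?C" unfolding ab by (simp add: algebra_simps)
  also have "a*z - d*w + b*y - c*x = m * ?D" unfolding ab by (simp add: algebra_simps)
  also have "(m * ?A)\<^sup>2 + (m * ?B)\<^sup>2 + (m * ?C)\<^sup>2 + (m * ?D)\<^sup>2
      = m\<^sup>2 * (?A\<^sup>2 + ?B\<^sup>2 + ?C\<^sup>2 + ?D\<^sup>2)"
    by (subst (1 2 3 4) power_mult_distrib) (simp only: distrib_left)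
  finally have "k * p = ?A\<^sup>2 + ?B\<^sup>2 + ?C\<^sup>2 + ?D\<^sup>2" using m0 by simp
  then show ?thesis using that k0 km unfolding sum4sq_def by blast
qed

lemma sum4sq_prime_of_multiple:
  assumes "prime p" "0 < m" "m < p" "sum4sq (m * p)"
  shows "sum4sq p"
  using assms(2-)
proof (induction "nat m" arbitrary: m rule: less_induct)
  case less
  consider "m = 1" | k where "m = 2 * k" | "odd m" "m > 1"
    using less.prems by (metis evenE int_one_le_iff_zero_less order_le_less)
  then show ?case
  proof cases
    case 1
    then show ?thesis using less.prems by simp
  next
    case (2 k)
    have "sum4sq (k * p)" by (rule sum4sq_half) (use less.prems 2 in \<open>simp add: mult.assoc\<close>)
    then show ?thesis using 2 less.prems by (intro less.hyps[of k]) auto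
  next
    case 3
    then have "\<not> m dvd p" using assms(1) less.prems unfolding prime_int_iff
      by (metis less_irrefl less_imp_le)
    then obtain r where "0 < r" "r < m" "sum4sq (r * p)"
      using sum4sq_descent[of m p] 3 less.prems by blast
    then show ?thesis using less.prems by (intro less.hyps[of r]) auto
  qed
qed

lemma sum4sq_prime:
  assumes "prime (p::int)"
  shows "sum4sq p"
proof (cases "p = 2")
  case True
  have "(2::int) = 1\<^sup>2 + 1\<^sup>2 + 0\<^sup>2 + 0\<^sup>2" by simp
  then show ?thesis unfolding True sum4sq_def by blast
next
  case False
  have p: "p > 1" using assms prime_gt_1_int by blast
  have odd: "odd p" using assms False p by (intro prime_odd_int) auto
  obtain x y where xy: "0 \<le> x" "x \<le> p div 2" "0 \<le> y" "y \<le> p div 2" "p dvd x\<^sup>2 + y\<^sup>2 + 1"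
    using prime_dvd_two_squares_plus_one[OF assms odd] .
  then obtain m where m: "x\<^sup>2 + y\<^sup>2 + 1 = p * m" by blast
  have "0 < p * m" unfolding m[symmetric] by (intro add_nonneg_pos) simp_all
  then have m0: "m > 0" using p by (simp add: zero_less_mult_iff)
  \<comment> \<open>Both squares lie below p^2/4, so the multiplier \<open>m\<close> starts below
    \<open>p\<close>, as the descent requires.\<close>
  have "2 * x < p" "2 * y < p" using xy odd p by (auto elim!: oddE)
  then have "(2 * x)\<^sup>2 < p\<^sup>2" "(2 * y)\<^sup>2 < p\<^sup>2" using xy by (intro power_strict_mono; simp)+
  moreover have "1 < p\<^sup>2" using p by simp
  ultimately have "p * m < p * p" using m by (simp add: power2_eq_square)
  then have "m < p" using p by simp
  moreover have "m * p = x\<^sup>2 + y\<^sup>2 + 1\<^sup>2 + 0\<^sup>2" using m by (simp add: mult.commute)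
  then have "sum4sq (m * p)" unfolding sum4sq_def by blast
  ultimately show ?thesis using sum4sq_prime_of_multiple[OF assms m0] by blast
qed

lemma sum4sq_of_nat: "sum4sq (int n)"
proof (induction n rule: less_induct)
  case (less n)
  consider "n = 0" | "n = 1" | "n > 1" by linarith
  then show ?case
  proof cases
    case 1
    have "(0::int) = 0\<^sup>2 + 0\<^sup>2 + 0\<^sup>2 + 0\<^sup>2" by simp
    then show ?thesis unfolding 1 sum4sq_def of_nat_0 by blast
  next
    case 2
    have "(1::int) = 1\<^sup>2 + 0\<^sup>2 + 0\<^sup>2 + 0\<^sup>2" by simp
    then show ?thesis unfolding 2 sum4sq_def of_nat_1 by blast
  next
    case 3
    then obtain p where p: "prime p" "p dvd n" using prime_factor_nat[of n] by auto
    then obtain k where k: "n = p * k" by blast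
    have "k < n" using k p 3 prime_gt_1_nat[OF p(1)] by (cases "k = 0") auto
    then have "sum4sq (int k)" by (rule less.IH)
    moreover have "sum4sq (int p)" using p by (intro sum4sq_prime) simp
    ultimately show ?thesis using k sum4sq_mult by simp
  qed
qed

theorem lagrange_four_squares:
  obtains a b c d :: nat where "n = a\<^sup>2 + b\<^sup>2 + c\<^sup>2 + d\<^sup>2"
proof -
  obtain a b c d where "int n = a\<^sup>2 + b\<^sup>2 + c\<^sup>2 + d\<^sup>2"
    using sum4sq_of_nat[of n] unfolding sum4sq_def by blast
  then have "int n = int ((nat \<bar>a\<bar>)\<^sup>2 + (nat \<bar>b\<bar>)\<^sup>2 + (nat \<bar>c\<bar>)\<^sup>2 + (nat \<bar>d\<bar>)\<^sup>2)" by simp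
  then have "n = (nat \<bar>a\<bar>)\<^sup>2 + (nat \<bar>b\<bar>)\<^sup>2 + (nat \<bar>c\<bar>)\<^sup>2 + (nat \<bar>d\<bar>)\<^sup>2"
    by (simp only: of_nat_eq_iff)
  then show ?thesis by (rule that)
qed

section \<open>Ten columns\<close>

text \<open>The list holds the columns of a two-row factor, so its length is the column count;
  \<open>nat\<close> entries make the factor integral and nonnegative from the outset.\<close>

definition gram_cols :: "(nat \<times> nat) list \<Rightarrow> nat \<Rightarrow> nat \<Rightarrow> nat \<Rightarrow> bool" where
  "gram_cols L a b c \<longleftrightarrow> (\<Sum>(x, y)\<leftarrow>L. x\<^sup>2) = a \<and> (\<Sum>(x, y)\<leftarrow>L. x * y) = b \<and> (\<Sum>(x, y)\<leftarrow>L. y\<^sup>2) = c"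

lemma gram_cols_swap:
  assumes "gram_cols L a b c"
  shows "gram_cols (map (\<lambda>(x, y). (y, x)) L) c b a"
  using assms by (simp add: gram_cols_def comp_def case_prod_unfold mult.commute)

text \<open>Adding the first row of the factor to the second keeps it nonnegative and keeps its
  width; this undoes the reduction step.\<close>

lemma gram_cols_shear:
  assumes "gram_cols L a b c"
  shows "gram_cols (map (\<lambda>(x, y). (x, x + y)) L) a (a + b) (a + 2 * b + c)"
proof -
  have "(\<Sum>(x, y)\<leftarrow>L. x * (x + y)) = (\<Sum>(x, y)\<leftarrow>L. x\<^sup>2) + (\<Sum>(x, y)\<leftarrow>L. x * y)"
    and "(\<Sum>(x, y)\<leftarrow>L. (x + y)\<^sup>2) =
      (\<Sum>(x, y)\<leftarrow>L. x\<^sup>2) + 2 * (\<Sum>(x, y)\<leftarrow>L. x * y) + (\<Sum>(x, y)\<leftarrow>L. y\<^sup>2)"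
    by (induction L) (auto simp: power2_eq_square algebra_simps)
  then show ?thesis
    using assms by (simp add: gram_cols_def comp_def case_prod_unfold)
qed

lemma gram_cols_pad:
  assumes "gram_cols L a b c"
  shows "gram_cols (L @ replicate n (0, 0)) a b c"
  using assms by (simp add: gram_cols_def sum_list_replicate)

text \<open>The offsets \<open>x + 1\<close> and \<open>- x\<close> are the diagonal entries of the
  column \<open>(x, x + 1)\<close> or \<open>(x + 1, x)\<close> less its product
  \<open>x * (x + 1)\<close>. The cut at \<open>k\<^sup>2 + k\<close> keeps \<open>x\<close> below
  \<open>f\<close> on either side.\<close>

lemma nearest_square:
  obtains f where "t = f\<^sup>2" | f x where "t = f\<^sup>2 + x + 1" "x < f"
  | f x :: nat where "t + x = f\<^sup>2" "x < f"
proof -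
  define k where "k = floor_sqrt t"
  have k: "k\<^sup>2 \<le> t" "t < (Suc k)\<^sup>2"
    by (simp_all add: k_def floor_sqrt_power2_le Suc_floor_sqrt_power2_gt)
  consider "t = k\<^sup>2" | "k\<^sup>2 < t" "t \<le> k\<^sup>2 + k" | "k\<^sup>2 + k < t" using k by linarith
  then show ?thesis
  proof cases
    case 1
    then show ?thesis using that(1) by blast
  next
    case 2
    then show ?thesis using that(2)[of k "t - k\<^sup>2 - 1"] by simp
  next
    case 3
    then show ?thesis using that(3)[of "(Suc k)\<^sup>2 - t" "Suc k"] k by (simp add: power2_eq_square)
  qed
qed

text \<open>
  The column \<open>(x, x + 1)\<close> or \<open>(x + 1, x)\<close> moves the second diagonal excess \<open>t\<close> to the nearest
  square.  Its product \<open>x * (x + 1)\<close> is below \<open>t\<close>, so the remaining off-diagonal part is nonnegative.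
\<close>

lemma ten_columns_small_excess:
  assumes "t \<le> s" "t \<le> b + 1"
  shows "\<exists>L. length L \<le> 10 \<and> gram_cols L (b + s) b (b + t)"
  using nearest_square[of t]
proof cases
  case (1 f)
  obtain p q r u where b: "b = p\<^sup>2 + q\<^sup>2 + r\<^sup>2 + u\<^sup>2" using lagrange_four_squares .
  obtain g h i j where s: "s = g\<^sup>2 + h\<^sup>2 + i\<^sup>2 + j\<^sup>2" using lagrange_four_squares .
  show ?thesis
    by (rule exI[of _ "[(p,p),(q,q),(r,r),(u,u),(g,0),(h,0),(i,0),(j,0),(0,f)]"])
      (use 1 b s in \<open>simp add: gram_cols_def power2_eq_square\<close>)
next
  case (2 f x)
  have "x * (x + 1) \<le> f * f" using 2 by (intro mult_mono) auto
  then have "x * (x + 1) \<le> b" using 2 assms(2) by (simp add: power2_eq_square)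
  then obtain b' where b': "b = b' + x * (x + 1)" using that[of "b - x * (x + 1)"] by simp
  obtain p q r u where b: "b' = p\<^sup>2 + q\<^sup>2 + r\<^sup>2 + u\<^sup>2" using lagrange_four_squares .
  \<comment> \<open>The column \<open>(x, x + 1)\<close> adds \<open>x\<^sup>2\<close> to the first
    diagonal entry, which is \<open>x\<close> less than its product, so the first excess must make
    up \<open>x\<close>.\<close>
  obtain g h i j where s: "s + x = g\<^sup>2 + h\<^sup>2 + i\<^sup>2 + j\<^sup>2" using lagrange_four_squares .
  show ?thesis
    by (rule exI[of _ "[(p,p),(q,q),(r,r),(u,u),(g,0),(h,0),(i,0),(j,0),(0,f),(x,x+1)]"])
      (use 2 b' b s in \<open>simp add: gram_cols_def power2_eq_square\<close>)
next
  case (3 f x)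
  obtain d where d: "f = x + 1 + d" using 3(2) less_iff_Suc_add by auto
  \<comment> \<open>From \<open>f \<ge> x + 1\<close> follows t >= (x + 1)^2 - x. The column
    \<open>(x + 1, x)\<close> takes \<open>x + 1\<close> from the first excess, which
    \<open>t \<le> s\<close> makes affordable.\<close>
  have "x * (x + 1) + 1 \<le> t" "x + 1 \<le> t"
    using 3 unfolding d by (simp_all add: power2_eq_square algebra_simps)
  then have "x * (x + 1) \<le> b" "x + 1 \<le> s" using assms by linarith+
  then obtain b' s' where b': "b = b' + x * (x + 1)" "s = s' + (x + 1)"
    using that[of "b - x * (x + 1)" "s - (x + 1)"] by simp
  obtain p q r u where b: "b' = p\<^sup>2 + q\<^sup>2 + r\<^sup>2 + u\<^sup>2" using lagrange_four_squares .
  obtain g h i j where s: "s' = g\<^sup>2 + h\<^sup>2 + i\<^sup>2 + j\<^sup>2" using lagrange_four_squares .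
  show ?thesis
    by (rule exI[of _ "[(p,p),(q,q),(r,r),(u,u),(g,0),(h,0),(i,0),(j,0),(0,f),(x+1,x)]"])
      (use 3(1) b' b s in \<open>simp add: gram_cols_def power2_eq_square\<close>)
qed

text \<open>Two columns \<open>(x, y)\<close> and \<open>(z, w)\<close> realize \<open>b\<close>
  while their squares stay within \<open>a\<close> and \<open>c\<close>; four squares fill each
  diagonal remainder.\<close>

lemma ten_columns_large_diagonal:
  assumes "2 * b < a" "2 * b < c"
  shows "\<exists>L. length L \<le> 10 \<and> gram_cols L a b c"
proof -
  have *: ?thesis if h: "b = x * y + z * w" "x\<^sup>2 + z\<^sup>2 \<le> a" "y\<^sup>2 + w\<^sup>2 \<le> c" for x y z w
  proof -
    obtain a' c' where ac: "a = x\<^sup>2 + z\<^sup>2 + a'" "c = y\<^sup>2 + w\<^sup>2 + c'"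
      using le_Suc_ex[OF h(2)] le_Suc_ex[OF h(3)] by blast
    obtain g h i j where a': "a' = g\<^sup>2 + h\<^sup>2 + i\<^sup>2 + j\<^sup>2" using lagrange_four_squares .
    obtain p q r u where c': "c' = p\<^sup>2 + q\<^sup>2 + r\<^sup>2 + u\<^sup>2" using lagrange_four_squares .
    show ?thesis
      by (rule exI[of _ "[(x,y),(z,w),(g,0),(h,0),(i,0),(j,0),(0,p),(0,q),(0,r),(0,u)]"])
        (use h(1) ac a' c' in \<open>simp add: gram_cols_def\<close>)
  qed
  define k where "k = floor_sqrt b"
  have "k\<^sup>2 \<le> b" "b < (Suc k)\<^sup>2"
    by (simp_all add: k_def floor_sqrt_power2_le Suc_floor_sqrt_power2_gt)
  then have r: "b = k\<^sup>2 + (b - k\<^sup>2)" "b - k\<^sup>2 \<le> 2 * k" by (simp_all add: power2_eq_square)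
  define r where "r = b - k\<^sup>2"
  note r = r[folded r_def]
  show ?thesis
  \<comment> \<open>The columns are \<open>(k, k)\<close>, \<open>(1, r)\<close> if
    \<open>r \<le> k\<close>, and otherwise \<open>(k, k + 1)\<close>, \<open>(1, e + 1)\<close>
    with \<open>e + 1 \<le> k\<close>. The first row costs k^2 + 1 <= 2b + 1, the second at most
    2b.\<close>
  proof (cases "r \<le> k")
    case True
    have "r\<^sup>2 \<le> k\<^sup>2" using True by simp
    then show ?thesis using *[of k k 1 r] r assms by (simp add: power2_eq_square)
  next
    case False
    then obtain e where e: "r = k + 1 + e" using less_imp_Suc_add[of k r] by auto
    have "(e + 1)\<^sup>2 \<le> k\<^sup>2" using e r by simp
    then show ?thesis using *[of k "k + 1" 1 "e + 1"] r assms e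
      by (simp add: power2_eq_square)
  qed
qed

lemma ten_columns_dominant:
  assumes "b \<le> a" "b \<le> c"
  shows "\<exists>L. length L \<le> 10 \<and> gram_cols L a b c"
proof -
  obtain s t where st: "a = b + s" "c = b + t" using assms le_Suc_ex by blast
  consider "t \<le> s" "t \<le> b + 1" | "s \<le> t" "s \<le> b + 1" | "b + 1 < s" "b + 1 < t" by linarith
  then show ?thesis
  proof cases
    case 1
    then show ?thesis using ten_columns_small_excess[of t s b] st by blast
  next
    case 2
    then obtain L where "length L \<le> 10" "gram_cols L c b a"
      using ten_columns_small_excess[of s t b] st by blast
    then show ?thesis using gram_cols_swap[of L] by (intro exI[of _ "map (\<lambda>(x, y). (y, x)) L"]) simp
  next
    case 3
    then show ?thesis using st by (intro ten_columns_large_diagonal) auto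
  qed
qed

text \<open>The shear preserves the determinant, whose nonnegativity keeps \<open>c'\<close> a
  natural number. Positivity of \<open>a\<close> makes the trace drop.\<close>

lemma shear_nonneg_det:
  fixes a b c :: nat
  assumes "b\<^sup>2 \<le> a * c" "a < b"
  obtains b' c' where "b = a + b'" "c = a + 2 * b' + c'" "b'\<^sup>2 \<le> a * c'" "0 < a"
proof -
  have a: "0 < a" using assms by (cases a) auto
  obtain b' where b': "b = a + b'" using assms(2) less_imp_add_positive by blast
  have "a * (a + 2 * b') + b'\<^sup>2 \<le> a * c"
    using assms(1) b' by (simp add: power2_eq_square algebra_simps)
  moreover from this have "a * (a + 2 * b') \<le> a * c" by linarith
  then have "a + 2 * b' \<le> c" using a by simp
  then obtain c' where c': "c = a + 2 * b' + c'" using le_iff_add by blast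
  ultimately have "b'\<^sup>2 \<le> a * c'" by (simp add: algebra_simps)
  then show ?thesis using that b' c' a by blast
qed

text \<open>Induction on the trace: while \<open>b\<close> exceeds a diagonal entry, a shear lowers
  the trace, and the factor of the smaller matrix is sheared back.\<close>

lemma ten_columns:
  assumes "b\<^sup>2 \<le> a * c"
  shows "\<exists>L. length L \<le> 10 \<and> gram_cols L a b c"
  using assms
proof (induction "a + c" arbitrary: a b c rule: less_induct)
  case less
  consider "b \<le> a" "b \<le> c" | "a < b" | "c < b" by linarith
  then show ?case
  proof cases
    case 1
    then show ?thesis by (rule ten_columns_dominant)
  next
    case 2
    obtain b' c' where *: "b = a + b'" "c = a + 2 * b' + c'" "b'\<^sup>2 \<le> a * c'" "0 < a"
      using shear_nonneg_det[OF less.prems 2] .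
    then obtain L where "length L \<le> 10" "gram_cols L a b' c'"
      using less.hyps[of a c' b'] by auto
    then show ?thesis using gram_cols_shear[of L a b' c'] *
      by (intro exI[of _ "map (\<lambda>(x, y). (x, x + y)) L"]) simp
  next
    case 3
    have "b\<^sup>2 \<le> c * a" using less.prems by (simp add: mult.commute)
    from shear_nonneg_det[OF this 3] obtain b' a' where
      *: "b = c + b'" "a = c + 2 * b' + a'" "b'\<^sup>2 \<le> c * a'" "0 < c" .
    then obtain L where "length L \<le> 10" "gram_cols L c b' a'"
      using less.hyps[of c a' b'] by auto
    then obtain L where "length L \<le> 10" "gram_cols L c b a"
      using gram_cols_shear[of L c b' a'] * that[of "map (\<lambda>(x, y). (x, x + y)) L"] by simp
    then show ?thesis using gram_cols_swap[of L]
      by (intro exI[of _ "map (\<lambda>(x, y). (y, x)) L"]) simp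
  qed
qed

section \<open>Matrices\<close>

lemma mat_2_2_eqI:
  assumes "A \<in> carrier_mat 2 2" "B \<in> carrier_mat 2 2"
    and "A $$ (0,0) = B $$ (0,0)" "A $$ (0,1) = B $$ (0,1)"
    and "A $$ (1,0) = B $$ (1,0)" "A $$ (1,1) = B $$ (1,1)"
  shows "A = B"
  by (rule eq_matI) (use assms in \<open>auto simp: less_2_cases_iff\<close>)

lemma psd_2_2_det_nonneg:
  assumes A: "A \<in> carrier_mat 2 2" "pos_semidef_mat A"
    and e: "A $$ (0,0) = a" "A $$ (0,1) = b" "A $$ (1,0) = b" "A $$ (1,1) = c"
    and nn: "a \<ge> 0" "c \<ge> 0"
  shows "b\<^sup>2 \<le> a * c"
proof -
  have q: "0 \<le> a * u\<^sup>2 + 2 * b * u * v + c * v\<^sup>2" for u v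
  proof -
    let ?x = "vec 2 (\<lambda>i. if i = 0 then u else v)"
    have "?x \<in> carrier_vec 2" by simp
    then have "0 \<le> ?x \<bullet> (A *\<^sub>v ?x)" using A unfolding pos_semidef_mat_def by (metis carrier_matD(1))
    also have "\<dots> = a * u\<^sup>2 + 2 * b * u * v + c * v\<^sup>2"
    proof -
      have "A *\<^sub>v ?x = vec 2 (\<lambda>i. if i = 0 then a * u + b * v else b * u + c * v)"
        using A(1) e
        by (intro eq_vecI) (auto simp: scalar_prod_def numeral_2_eq_2 less_Suc_eq)
      then show ?thesis
        by (simp add: scalar_prod_def numeral_2_eq_2 power2_eq_square algebra_simps)
    qed
    finally show ?thesis .
  qed
  show ?thesis
  proof (cases "a = 0")
    case True
    \<comment> \<open>With \<open>a = 0\<close> the vector (-b, a) only gives 0 >= 0. The weight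
      \<open>c + 1\<close> makes the cross term outweigh \<open>c * b\<^sup>2\<close>, forcing
      \<open>b = 0\<close>.\<close>
    have "0 \<le> - (b\<^sup>2 * (c + 2))"
      using q[of "- (c + 1)" b] True by (simp add: power2_eq_square algebra_simps)
    then have "b\<^sup>2 \<le> 0" using nn(2) by (simp add: mult_le_0_iff)
    then show ?thesis using True by simp
  next
    case False
    \<comment> \<open>At (-b, a) the quadratic form equals \<open>a\<close> times the
      determinant.\<close>
    have "0 \<le> a * (a * c - b\<^sup>2)" using q[of "- b" a] by (simp add: power2_eq_square algebra_simps)
    then show ?thesis using False nn by (simp add: zero_le_mult_iff)
  qed
qed

lemma ten_column_factor:
  fixes a b c :: nat
  assumes "b\<^sup>2 \<le> a * c" "A \<in> carrier_mat 2 2"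
    and "A $$ (0,0) = real a" "A $$ (0,1) = real b" "A $$ (1,0) = real b" "A $$ (1,1) = real c"
  shows "\<exists>B \<in> carrier_mat 2 10. nonneg_mat B \<and> integer_mat B \<and> A = B * transpose_mat B"
proof -
  obtain L' where L': "length L' \<le> 10" "gram_cols L' a b c" using ten_columns assms(1) by blast
  \<comment> \<open>Zero columns bring the width to exactly ten and leave the product
    unchanged.\<close>
  define L where "L = L' @ replicate (10 - length L') (0, 0)"
  have L: "length L = 10" "gram_cols L a b c" using L' gram_cols_pad by (auto simp: L_def)
  define B where "B = mat 2 10 (\<lambda>(i, j). real (if i = 0 then fst (L ! j) else snd (L ! j)))"
  have B: "B \<in> carrier_mat 2 10" by (simp add: B_def)
  have "nonneg_mat B" "integer_mat B"
    unfolding nonneg_mat_def integer_mat_def elements_mat_def B_def by auto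
  have sums: "real a = (\<Sum>j<10. real (fst (L ! j)) * real (fst (L ! j)))"
    "real b = (\<Sum>j<10. real (fst (L ! j)) * real (snd (L ! j)))"
    "real c = (\<Sum>j<10. real (snd (L ! j)) * real (snd (L ! j)))"
    using L unfolding gram_cols_def
    by (auto simp: sum_list_sum_nth case_prod_unfold power2_eq_square atLeast0LessThan)
  have "A = B * transpose_mat B"
    by (rule mat_2_2_eqI)
      (use assms sums in \<open>auto simp: B_def scalar_prod_def atLeast0LessThan mult.commute\<close>)
  then show ?thesis using B \<open>nonneg_mat B\<close> \<open>integer_mat B\<close> by blast
qed

theorem theorem7:
  fixes A :: "real mat"
  assumes "A \<in> carrier_mat 2 2"
    and "doubly_nonneg_mat A"
    and "nonneg_mat A"
    and "integer_mat A"
  shows "(\<exists>B \<in> carrier_mat 2 10. nonneg_mat B \<and> integer_mat B \<and> A = B * transpose_mat B)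
    \<and> integer_cp_rank A \<le> 10"
proof -
  have "\<exists>n. A $$ (i, j) = real n" if "i < 2" "j < 2" for i j
  proof -
    have "A $$ (i, j) \<in> elements_mat A" using assms(1) that by auto
    then have "A $$ (i, j) \<in> \<int>" "A $$ (i, j) \<ge> 0"
      using assms(3,4) unfolding integer_mat_def nonneg_mat_def by auto
    then show ?thesis by (metis Ints_cases of_int_0_le_iff of_int_of_nat_eq zero_le_imp_eq_int)
  qed
  then obtain a b c where e: "A $$ (0,0) = real a" "A $$ (0,1) = real b" "A $$ (1,1) = real c"
    by (metis pos2 one_less_numeral_iff semiring_norm(76))
  have "transpose_mat A $$ (1,0) = A $$ (0,1)" using assms(1) by simp
  then have e': "A $$ (1,0) = real b"
    using assms(2) e unfolding doubly_nonneg_mat_def symmetric_mat_def by simp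
  have "(real b)\<^sup>2 \<le> real a * real c"
    by (rule psd_2_2_det_nonneg[OF assms(1) _ e(1,2) e' e(3)])
      (use assms(2) in \<open>auto simp: doubly_nonneg_mat_def\<close>)
  then have "b\<^sup>2 \<le> a * c" by (simp flip: of_nat_mult of_nat_power)
  then obtain B where B: "B \<in> carrier_mat 2 10" "nonneg_mat B" "integer_mat B"
    "A = B * transpose_mat B"
    using ten_column_factor[OF _ assms(1) e(1,2) e' e(3)] by blast
  have "integer_cp_rank A \<le> enat (dim_col B)"
    unfolding integer_cp_rank_def by (rule INF_lower) (use B in auto)
  then have "integer_cp_rank A \<le> 10" using B(1) by (simp add: numeral_eq_enat)
  then show ?thesis using B by blast
qed

end
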